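(* For any graphs $G$ and $H$, the Cartesian product $G\,\square\,H$ satisfies $$\mathrm{tww}(G\,\square\,H)\le \max\{\mathrm{tww}(G)+\Delta(H),\ \mathrm{tww}(H)\}+\Delta(H).$$
   Context: All graphs are finite and simple (no loops or multiple edges). $\Delta(H)$ is the maximum degree of $H$. Twin-width. A trigraph $G$ has a vertex set $V(G)$, a set $E(G)$ of black edges and a set $R(G)$ of red edges, with $E(G)\cap R(G)=\emptyset$; a graph is a trigraph with no red edges. $N_G(v)$ is the set of vertices joined to $v$ by a black or red edge. A $d$-trigraph is a trigraph in which every vertex is incident with at most $d$ red edges. A contraction merges two distinct (not necessarily adjacent) vertices $u,v$ into a new vertex $w$: every vertex other than $u,v$ in $N_G(u)\triangle N_G(v)$ is joined to $w$ by a red edge; every $x\in N_G(u)\cap N_G(v)$ is joined to $w$ by a black edge if $ux,vx\in E(G)$ and by a red edge otherwise; all edges not incident with $u$ or $v$ are unchanged, and $u,v$ and their incident edges are removed. A $d$-sequence of an $n$-vertex graph $G$ is a sequence of $d$-trigraphs $G_n=G,G_{n-1},\dots,G_1=K_1$ with each $G_{i-1}$ obtained from $G_i$ by one contraction. The twin-width $\mathrm{tww}(G)$ is the least $d$ such that $G$ admits a $d$-sequence. Cartesian product. $G\,\square\,H$ has vertex set $V(G)\times V(H)$, and $(u,i)(v,j)$ is an edge iff [$u=v$ and $ij\in E(H)$] or [$i=j$ and $uv\in E(G)$]. *)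

theory Defs
  imports Main
begin

text \<open>Edges, black or red, are two-element sets of vertices.\<close>

record 'a trigraph =
  verts :: "'a set"
  black :: "'a set set"
  red :: "'a set set"

definition is_trigraph :: "'a trigraph \<Rightarrow> bool" where
  "is_trigraph G \<longleftrightarrow> finite (verts G) \<and>
     (\<forall>e \<in> black G \<union> red G. e \<subseteq> verts G \<and> card e = 2) \<and>
     black G \<inter> red G = {}"

definition is_graph :: "'a trigraph \<Rightarrow> bool" where
  "is_graph G \<longleftrightarrow> is_trigraph G \<and> red G = {}"

definition nbhd :: "'a trigraph \<Rightarrow> 'a \<Rightarrow> 'a set" where
  "nbhd G v = {x. {v, x} \<in> black G \<union> red G}"

definition is_d_trigraph :: "nat \<Rightarrow> 'a trigraph \<Rightarrow> bool" where
  "is_d_trigraph d G \<longleftrightarrow> is_trigraph G \<and> (\<forall>v \<in> verts G. card {e \<in> red G. v \<in> e} \<le> d)"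

text \<open>The element \<open>0\<close> only matters for the graph without vertices.\<close>

definition max_degree :: "'a trigraph \<Rightarrow> nat" where
  "max_degree G = Max (insert 0 ((\<lambda>v. card (nbhd G v)) ` verts G))"

definition contract :: "'a \<Rightarrow> 'a \<Rightarrow> 'a \<Rightarrow> 'a trigraph \<Rightarrow> 'a trigraph" where
  "contract u v w G =
     \<lparr> verts = insert w (verts G - {u, v}),
       black = {e \<in> black G. u \<notin> e \<and> v \<notin> e} \<union>
               {{w, x} | x. x \<in> nbhd G u \<inter> nbhd G v \<and> {u, x} \<in> black G \<and> {v, x} \<in> black G},
       red = {e \<in> red G. u \<notin> e \<and> v \<notin> e} \<union>
             {{w, x} | x. x \<in> sym_diff (nbhd G u) (nbhd G v) - {u, v}} \<union>
             {{w, x} | x. x \<in> nbhd G u \<inter> nbhd G v \<and> \<not> ({u, x} \<in> black G \<and> {v, x} \<in> black G)} \<rparr>"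

text \<open>The merged vertex \<open>w\<close> must differ from every remaining vertex, but it may reuse the
  name \<open>u\<close> or \<open>v\<close>: the type \<open>'a\<close> may be finite and all its elements may be vertices, and
  then no other name exists. The choice of name only affects the result up to isomorphism.\<close>

definition contracts_to :: "'a trigraph \<Rightarrow> 'a trigraph \<Rightarrow> bool" where
  "contracts_to G G' \<longleftrightarrow>
     (\<exists>u v w. u \<in> verts G \<and> v \<in> verts G \<and> u \<noteq> v \<and> w \<notin> verts G - {u, v} \<and>
              G' = contract u v w G)"

definition is_d_sequence :: "nat \<Rightarrow> 'a trigraph \<Rightarrow> (nat \<Rightarrow> 'a trigraph) \<Rightarrow> bool" where
  "is_d_sequence d G T \<longleftrightarrow>
     (let n = card (verts G) in
        T n = G \<and>
        (\<exists>x. T 1 = \<lparr>verts = {x}, black = {}, red = {}\<rparr>) \<and>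
        (\<forall>i \<in> {1..n}. is_d_trigraph d (T i)) \<and>
        (\<forall>i \<in> {2..n}. contracts_to (T i) (T (i - 1))))"

text \<open>The graph without vertices has no contraction sequence ending in a one-vertex graph;
  its twin-width is set to \<open>0\<close>, as is usual.\<close>

definition tww :: "'a trigraph \<Rightarrow> nat" where
  "tww G = (if verts G = {} then 0 else (LEAST d. \<exists>T. is_d_sequence d G T))"

definition cart_prod :: "'a trigraph \<Rightarrow> 'b trigraph \<Rightarrow> ('a \<times> 'b) trigraph"  (infixl "\<box>" 70) where
  "G \<box> H =
     \<lparr> verts = verts G \<times> verts H,
       black = {{(u, i), (v, j)} | u i v j.
                  (u, i) \<in> verts G \<times> verts H \<and> (v, j) \<in> verts G \<times> verts H \<and>
                  ((u = v \<and> {i, j} \<in> black H) \<or> (i = j \<and> {u, v} \<in> black G))},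
       red = {} \<rparr>"

end

theory Submission
  imports Defs
begin

text \<open>A trigraph reached from a graph by contractions is a quotient of the graph by a labelling of
  its vertices: two labels are joined in black if their classes are completely adjacent, and in red
  if their classes are partially adjacent. To contract \<open>G \<box> H\<close>, follow a contraction sequence of
  \<open>G\<close> and perform each contraction in the copies of \<open>G\<close> one after the other. Within a copy the red
  degree is at most \<open>tww G\<close>, and a class meets at most two classes in each neighbouring copy, whence
  \<open>tww G + 2 \<Delta>(H)\<close>. What remains is a quotient of \<open>H\<close> in which any edge may be red; following a
  contraction sequence of \<open>H\<close>, a class has at most \<open>tww H\<close> red neighbours and, since a class joined
  in black contains a neighbour of every vertex, at most \<open>\<Delta>(H)\<close> black ones.\<close>

section \<open>Contraction steps\<close>

text \<open>The degree bound is imposed on the target only, so that steps chain under the reflexive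
  transitive closure; the bound on the initial trigraph is carried as a separate hypothesis.\<close>

definition step :: "nat \<Rightarrow> 'a trigraph \<Rightarrow> 'a trigraph \<Rightarrow> bool" where
  "step d A B \<longleftrightarrow> contracts_to A B \<and> is_d_trigraph d B"

abbreviation single :: "'a \<Rightarrow> 'a trigraph" where
  "single x \<equiv> \<lparr>verts = {x}, black = {}, red = {}\<rparr>"

lemma is_d_trigraph_single: "is_d_trigraph d (single x)"
  by (simp add: is_d_trigraph_def is_trigraph_def)

text \<open>A \<open>d\<close>-sequence is indexed by vertex counts. This drop by exactly one is
  what lets a chain of steps be renumbered as such a sequence.\<close>

lemma card_contracts_to:
  assumes "contracts_to A B" and "finite (verts A)"
  shows "card (verts A) = Suc (card (verts B))"
proof -
  obtain u v w where h: "u \<in> verts A" "v \<in> verts A" "u \<noteq> v" "w \<notin> verts A - {u, v}"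
    and B: "B = contract u v w A"
    using assms(1) by (auto simp: contracts_to_def)
  have "card (verts B) = Suc (card (verts A - {u, v}))"
    using h assms(2) by (simp add: B contract_def)
  moreover have "card (verts A) = card (verts A - {u, v}) + 2"
    using h assms(2) card_Diff_subset[of "{u, v}" "verts A"] card_mono[of "verts A" "{u, v}"] by simp
  ultimately show ?thesis by simp
qed

lemma steps_if_d_sequence:
  assumes T: "is_d_sequence d G T" and ne: "verts G \<noteq> {}" and fin: "finite (verts G)"
  shows "is_d_trigraph d G \<and> (\<exists>x. (step d)\<^sup>*\<^sup>* G (single x))"
proof -
  let ?n = "card (verts G)"
  have n: "1 \<le> ?n"
    using ne fin by (simp add: Suc_le_eq card_gt_0_iff)
  have Tn: "T ?n = G" and Td: "\<And>i. i \<in> {1..?n} \<Longrightarrow> is_d_trigraph d (T i)"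
    and Tc: "\<And>i. i \<in> {2..?n} \<Longrightarrow> contracts_to (T i) (T (i - 1))"
    using T by (auto simp: is_d_sequence_def Let_def)
  obtain x where x: "T 1 = single x"
    using T by (auto simp: is_d_sequence_def Let_def)
  have "(step d)\<^sup>*\<^sup>* (T ?n) (T 1)"
    using n
  proof (induction rule: inc_induct)
    case (step i)
    have "step d (T (Suc i)) (T i)"
      using Tc[of "Suc i"] Td[of i] step.hyps by (simp add: step_def)
    then show ?case
      using step.IH by (meson rtranclp.rtrancl_into_rtrancl)
  qed simp
  then show ?thesis
    using Td[of ?n] n Tn x by auto
qed

lemma d_sequence_if_steps:
  assumes "(step d)\<^sup>*\<^sup>* G (single x)" and "is_d_trigraph d G"
  shows "\<exists>T. is_d_sequence d G T"
  using assms
proof (induction rule: converse_rtranclp_induct)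
  case base
  have "is_d_sequence d (single x) (\<lambda>_. single x)"
    by (auto simp: is_d_sequence_def is_d_trigraph_single)
  then show ?case by blast
next
  case (step A B)
  have c: "contracts_to A B" and B: "is_d_trigraph d B"
    using step.hyps by (auto simp: step_def)
  obtain T where T: "is_d_sequence d B T"
    using step.IH B by blast
  let ?m = "card (verts B)"
  have fin: "finite (verts A)" "finite (verts B)"
    using step.prems B by (auto simp: is_d_trigraph_def is_trigraph_def)
  have m: "card (verts A) = Suc ?m"
    using card_contracts_to[OF c fin(1)] .
  \<comment> \<open>The merged vertex lies in \<open>B\<close>, so \<open>Suc ?m\<close> is at least
    2 and the update at \<open>Suc ?m\<close> leaves the final trigraph at index 1 intact.\<close>
  have "?m \<noteq> 0"
    using c fin by (auto simp: contracts_to_def contract_def)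
  then have "is_d_sequence d A (T(Suc ?m := A))"
    using T step.prems c by (auto simp: is_d_sequence_def Let_def m le_Suc_eq)
  then show ?case by blast
qed

section \<open>Quotients of a graph by a labelling\<close>

definition some_adj :: "'a trigraph \<Rightarrow> ('a \<Rightarrow> 'c) \<Rightarrow> 'c \<Rightarrow> 'c \<Rightarrow> bool" where
  "some_adj G f p q \<longleftrightarrow>
     (\<exists>x\<in>verts G. \<exists>y\<in>verts G. f x = p \<and> f y = q \<and> {x, y} \<in> black G)"

definition all_adj :: "'a trigraph \<Rightarrow> ('a \<Rightarrow> 'c) \<Rightarrow> 'c \<Rightarrow> 'c \<Rightarrow> bool" where
  "all_adj G f p q \<longleftrightarrow>
     (\<forall>x\<in>verts G. \<forall>y\<in>verts G. f x = p \<longrightarrow> f y = q \<longrightarrow> {x, y} \<in> black G)"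

text \<open>\<open>all_adj\<close> is vacuous for a label with an empty class, so black edges also
  demand \<open>some_adj\<close>. Edges inside a class vanish through \<open>p \<noteq> q\<close>.
  The label type is independent of the vertex type.\<close>

definition quot :: "'a trigraph \<Rightarrow> ('a \<Rightarrow> 'c) \<Rightarrow> 'c trigraph" where
  "quot G f =
     \<lparr> verts = f ` verts G,
       black = {{p, q} | p q. p \<noteq> q \<and> some_adj G f p q \<and> all_adj G f p q},
       red = {{p, q} | p q. p \<noteq> q \<and> some_adj G f p q \<and> \<not> all_adj G f p q} \<rparr>"

lemma some_adj_commute: "some_adj G f p q \<longleftrightarrow> some_adj G f q p"
proof -
  have "{x, y} \<in> black G \<longleftrightarrow> {y, x} \<in> black G" for x y
    by (simp add: insert_commute)
  then show ?thesis
    unfolding some_adj_def by blast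
qed

lemma all_adj_commute: "all_adj G f p q \<longleftrightarrow> all_adj G f q p"
proof -
  have "{x, y} \<in> black G \<longleftrightarrow> {y, x} \<in> black G" for x y
    by (simp add: insert_commute)
  then show ?thesis
    unfolding all_adj_def by blast
qed

lemma some_adj_labels: "some_adj G f p q \<Longrightarrow> p \<in> f ` verts G \<and> q \<in> f ` verts G"
  by (auto simp: some_adj_def)

lemma verts_quot [simp]: "verts (quot G f) = f ` verts G"
  by (simp add: quot_def)

lemma black_quot_iff:
  "{p, q} \<in> black (quot G f) \<longleftrightarrow> p \<noteq> q \<and> some_adj G f p q \<and> all_adj G f p q"
  using some_adj_commute[of G f] all_adj_commute[of G f]
  by (auto simp: quot_def doubleton_eq_iff)

lemma red_quot_iff:
  "{p, q} \<in> red (quot G f) \<longleftrightarrow> p \<noteq> q \<and> some_adj G f p q \<and> \<not> all_adj G f p q"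
  using some_adj_commute[of G f] all_adj_commute[of G f]
  by (auto simp: quot_def doubleton_eq_iff)

lemma nbhd_quot_iff: "q \<in> nbhd (quot G f) p \<longleftrightarrow> p \<noteq> q \<and> some_adj G f p q"
  by (auto simp: nbhd_def black_quot_iff red_quot_iff)

lemma quot_cong:
  assumes "\<And>x. x \<in> verts G \<Longrightarrow> f x = g x"
  shows "quot G f = quot G g"
proof -
  have "some_adj G f = some_adj G g" "all_adj G f = all_adj G g"
    using assms by (simp_all add: some_adj_def all_adj_def fun_eq_iff)
  then show ?thesis
    using assms by (simp add: quot_def)
qed

lemma is_trigraph_quot:
  assumes "finite (verts G)"
  shows "is_trigraph (quot G f)"
proof -
  have "e \<notin> red (quot G f)" if "e \<in> black (quot G f)" for e
    using that black_quot_iff[of _ _ G f] red_quot_iff[of _ _ G f]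
    by (auto simp: quot_def doubleton_eq_iff all_adj_commute)
  then show ?thesis
    using assms some_adj_labels[of G f]
    by (auto simp: is_trigraph_def quot_def)
qed

lemma trigraph_eqI:
  assumes "verts A = verts B"
    and "\<And>e. e \<in> black A \<union> red A \<union> black B \<union> red B \<Longrightarrow> \<exists>p q. e = {p, q}"
    and "\<And>p q. {p, q} \<in> black A \<longleftrightarrow> {p, q} \<in> black B"
    and "\<And>p q. {p, q} \<in> red A \<longleftrightarrow> {p, q} \<in> red B"
  shows "A = (B :: 'a trigraph)"
proof -
  have "black A = black B" "red A = red B"
    using assms by (metis (no_types, lifting) UnCI subsetI subset_antisym)+
  with assms(1) show ?thesis
    by (simp add: trigraph.equality)
qed

lemma graph_edgeD:
  assumes "is_graph G" and "{p, q} \<in> black G"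
  shows "p \<noteq> q" and "p \<in> verts G" and "q \<in> verts G"
proof -
  have "{p, q} \<subseteq> verts G" "card {p, q} = 2"
    using assms by (simp_all only: is_graph_def is_trigraph_def) blast+
  then show "p \<noteq> q" "p \<in> verts G" "q \<in> verts G"
    by auto
qed

lemma quot_id:
  assumes "is_graph G"
  shows "quot G id = G"
proof (rule trigraph_eqI)
  have "red G = {}"
    using assms by (simp add: is_graph_def)
  then show "{p, q} \<in> red (quot G id) \<longleftrightarrow> {p, q} \<in> red G" for p q
    by (auto simp: red_quot_iff some_adj_def all_adj_def)
  show "{p, q} \<in> black (quot G id) \<longleftrightarrow> {p, q} \<in> black G" for p q
    using graph_edgeD[OF assms, of p q]
    by (auto simp: black_quot_iff some_adj_def all_adj_def)
  show "\<exists>p q. e = {p, q}" if "e \<in> black (quot G id) \<union> red (quot G id) \<union> black G \<union> red G" for e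
  proof -
    have "e \<in> black G \<Longrightarrow> card e = 2"
      using assms by (simp add: is_graph_def is_trigraph_def)
    then show ?thesis
      using that \<open>red G = {}\<close> by (auto simp: quot_def card_2_iff)
  qed
qed simp

lemma quot_const:
  assumes "\<And>x. x \<in> verts G \<Longrightarrow> f x = c" and "verts G \<noteq> {}"
  shows "quot G f = single c"
  using assms by (force simp: quot_def some_adj_def)

text \<open>Red edges at \<open>p\<close> correspond bijectively to their other ends, so degrees can
  be bounded by counting labels instead of edges.\<close>

lemma is_d_trigraph_quot_iff:
  assumes "finite (verts G)"
  shows "is_d_trigraph d (quot G f) \<longleftrightarrow>
    (\<forall>p \<in> f ` verts G. card {q. {p, q} \<in> red (quot G f)} \<le> d)"
proof -
  have "{e \<in> red (quot G f). p \<in> e} = (\<lambda>q. {p, q}) ` {q. {p, q} \<in> red (quot G f)}" for p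
    by (auto simp: quot_def insert_commute)
  moreover have "inj_on (\<lambda>q. {p, q}) A" for p :: 'b and A
    by (auto simp: inj_on_def doubleton_eq_iff)
  ultimately have "card {e \<in> red (quot G f). p \<in> e} = card {q. {p, q} \<in> red (quot G f)}" for p
    by (simp add: card_image)
  then show ?thesis
    using is_trigraph_quot[OF assms, of f] by (simp add: is_d_trigraph_def)
qed

section \<open>Contractions as merging of labels\<close>

definition merge :: "'c \<Rightarrow> 'c \<Rightarrow> 'c \<Rightarrow> 'c \<Rightarrow> 'c" where
  "merge u v w p = (if p = u \<or> p = v then w else p)"

text \<open>The class of \<open>w\<close> is the union of the classes of \<open>u\<close> and
  \<open>v\<close>: another class is completely adjacent to it iff it is so to both, and has an edge
  to it iff it has one to either. This is the contraction rule for colours. The name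
  \<open>w\<close> may be \<open>u\<close> or \<open>v\<close>, hence the side conditions on labels
  below.\<close>

lemma contract_quot:
  assumes uv: "u \<in> f ` verts G" "v \<in> f ` verts G" "u \<noteq> v" and w: "w \<notin> f ` verts G - {u, v}"
  shows "contract u v w (quot G f) = quot G (merge u v w \<circ> f)"
    (is "?A = quot G ?g")
proof (rule trigraph_eqI)
  show "verts ?A = verts (quot G ?g)"
    using uv by (auto simp: contract_def merge_def image_iff)
  show "\<exists>p q. e = {p, q}" if "e \<in> black ?A \<union> red ?A \<union> black (quot G ?g) \<union> red (quot G ?g)" for e
    using that by (auto simp: contract_def quot_def)
  have g_w: "?g x = w \<longleftrightarrow> f x = u \<or> f x = v" if "x \<in> verts G" for x
    using w that by (auto simp: merge_def)
  have g_other: "?g x = p \<longleftrightarrow> f x = p \<and> p \<noteq> u \<and> p \<noteq> v" if "x \<in> verts G" "p \<noteq> w" for x p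
    using that by (auto simp: merge_def)
  have some_w: "some_adj G ?g w q \<longleftrightarrow> (q \<noteq> u \<and> q \<noteq> v) \<and> (some_adj G f u q \<or> some_adj G f v q)"
    if "q \<noteq> w" for q
    unfolding some_adj_def using g_w g_other[OF _ that] by blast
  have some_other: "some_adj G ?g p q \<longleftrightarrow> p \<notin> {u, v} \<and> q \<notin> {u, v} \<and> some_adj G f p q"
    if "p \<noteq> w" "q \<noteq> w" for p q
    unfolding some_adj_def using g_other that by blast
  have all_w: "all_adj G ?g w q \<longleftrightarrow> all_adj G f u q \<and> all_adj G f v q"
    if "q \<noteq> w" "q \<noteq> u" "q \<noteq> v" for q
    unfolding all_adj_def using g_w g_other that by blast
  have all_other: "all_adj G ?g p q \<longleftrightarrow> all_adj G f p q"
    if "p \<noteq> w" "q \<noteq> w" "p \<notin> {u, v}" "q \<notin> {u, v}" for p q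
    unfolding all_adj_def using g_other that by blast
  \<comment> \<open>The classes are non-empty. Hence a label adjacent to only one of
    \<open>u\<close> and \<open>v\<close> cannot be completely adjacent to both, and its edge to
    \<open>w\<close> is red, as the symmetric difference in \<open>contract\<close>
    requires.\<close>
  have some_if_all: "some_adj G f u q" "some_adj G f v q"
    if "all_adj G f u q" "all_adj G f v q" "q \<in> f ` verts G" for q
    using that uv unfolding some_adj_def all_adj_def by blast+
  have labels: "\<not> some_adj G f p w" "\<not> some_adj G f w p" if "w \<notin> {u, v}" for p
    using w some_adj_labels[of G f] that by blast+
  have "({p, q} \<in> black ?A \<longleftrightarrow> {p, q} \<in> black (quot G ?g)) \<and>
        ({p, q} \<in> red ?A \<longleftrightarrow> {p, q} \<in> red (quot G ?g))" for p q
  proof -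
    have w_case: "({w, q} \<in> black ?A \<longleftrightarrow> {w, q} \<in> black (quot G ?g)) \<and>
        ({w, q} \<in> red ?A \<longleftrightarrow> {w, q} \<in> red (quot G ?g))" for q
    proof (cases "q = w \<or> q = u \<or> q = v")
      case True
      then show ?thesis
        using labels some_w
        by (auto simp: contract_def black_quot_iff red_quot_iff nbhd_quot_iff doubleton_eq_iff)
    next
      case False
      then show ?thesis
        using labels some_w[of q] all_w[of q] some_if_all[of q] some_adj_labels[of G f _ q]
        by (auto simp: contract_def black_quot_iff red_quot_iff nbhd_quot_iff doubleton_eq_iff)
    qed
    show ?thesis
    proof (cases "p = w \<or> q = w")
      case True
      then show ?thesis
        using w_case[of p] w_case[of q] by (auto simp: insert_commute)
    next
      case False
      then show ?thesis
        using some_other[of p q] all_other[of p q]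
        by (auto simp: contract_def black_quot_iff red_quot_iff doubleton_eq_iff)
    qed
  qed
  then show "{p, q} \<in> black ?A \<longleftrightarrow> {p, q} \<in> black (quot G ?g)"
    and "{p, q} \<in> red ?A \<longleftrightarrow> {p, q} \<in> red (quot G ?g)" for p q
    by blast+
qed

lemma step_quotI:
  assumes "u \<in> f ` verts G" "v \<in> f ` verts G" "u \<noteq> v" "w \<notin> f ` verts G - {u, v}"
    and g: "\<And>x. x \<in> verts G \<Longrightarrow> g x = merge u v w (f x)"
    and "is_d_trigraph d (quot G g)"
  shows "step d (quot G f) (quot G g)"
proof -
  have "quot G g = quot G (merge u v w \<circ> f)"
    using g by (intro quot_cong) simp
  then have "quot G g = contract u v w (quot G f)"
    using contract_quot assms(1-4) by metis
  then show ?thesis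
    using assms by (auto simp: step_def contracts_to_def)
qed

text \<open>Every step out of a quotient ends in a quotient of the same graph, so a contraction
  sequence can be followed through labellings alone.\<close>

lemma step_quotE:
  assumes "step d (quot G f) B"
  obtains u v w where "u \<in> f ` verts G" "v \<in> f ` verts G" "u \<noteq> v" "w \<notin> f ` verts G - {u, v}"
    "B = quot G (merge u v w \<circ> f)" "is_d_trigraph d (quot G (merge u v w \<circ> f))"
proof -
  obtain u v w where h: "u \<in> f ` verts G" "v \<in> f ` verts G" "u \<noteq> v" "w \<notin> f ` verts G - {u, v}"
    and B: "B = contract u v w (quot G f)" "is_d_trigraph d B"
    using assms by (auto simp: step_def contracts_to_def)
  then show thesis
    using that[OF h] contract_quot[OF h] by simp
qed

text \<open>Ensures that the \<open>LEAST\<close> in \<open>tww\<close> ranges over a non-empty set: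
  no red degree in a quotient exceeds the number of vertices of \<open>G\<close>, so labels can be
  merged in any order.\<close>

lemma ex_steps_to_single:
  assumes "finite (verts G)" and "verts G \<noteq> {}"
  shows "\<exists>x. (step (card (verts G)))\<^sup>*\<^sup>* (quot G (f :: 'a \<Rightarrow> 'c)) (single x)"
proof (induction "card (f ` verts G)" arbitrary: f rule: less_induct)
  case less
  have triv: "is_d_trigraph (card (verts G)) (quot G g)" for g :: "'a \<Rightarrow> 'c"
  proof -
    have "{q. {p, q} \<in> red (quot G g)} \<subseteq> g ` verts G" for p
      using some_adj_labels[of G g] by (auto simp: red_quot_iff)
    then have "card {q. {p, q} \<in> red (quot G g)} \<le> card (verts G)" for p
      by (meson assms(1) card_image_le card_mono finite_imageI order_trans)
    then show ?thesis
      by (simp add: is_d_trigraph_quot_iff[OF assms(1)])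
  qed
  show ?case
  proof (cases "\<exists>u \<in> f ` verts G. \<exists>v \<in> f ` verts G. u \<noteq> v")
    case True
    then obtain u v where uv: "u \<in> f ` verts G" "v \<in> f ` verts G" "u \<noteq> v" by blast
    \<comment> \<open>Reusing the name \<open>u\<close> avoids asking for a fresh label, which the
      type may not have.\<close>
    let ?g = "merge u v u \<circ> f"
    have "step (card (verts G)) (quot G f) (quot G ?g)"
      using uv triv by (intro step_quotI[of u _ _ v u]) auto
    moreover have "card (?g ` verts G) < card (f ` verts G)"
    proof (rule psubset_card_mono)
      have "v \<notin> ?g ` verts G" "?g ` verts G \<subseteq> f ` verts G"
        using uv by (auto simp: merge_def)
      then show "?g ` verts G \<subset> f ` verts G"
        using uv(2) by blast
    qed (use assms in simp)
    then obtain x where "(step (card (verts G)))\<^sup>*\<^sup>* (quot G ?g) (single x)"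
      using less by blast
    ultimately have "(step (card (verts G)))\<^sup>*\<^sup>* (quot G f) (single x)"
      by (rule converse_rtranclp_into_rtranclp)
    then show ?thesis ..
  next
    case False
    obtain x where "x \<in> verts G" using assms(2) by blast
    with False have "f y = f x" if "y \<in> verts G" for y
      using that by blast
    then have "quot G f = single (f x)"
      using assms(2) by (rule quot_const)
    then show ?thesis by auto
  qed
qed

section \<open>Twin-width as reachability by steps\<close>

lemma is_d_trigraph_graph: "is_graph G \<Longrightarrow> is_d_trigraph d G"
  by (simp add: is_graph_def is_d_trigraph_def)

text \<open>The form in which an optimal sequence is used: starting from \<open>quot G id\<close>,
  it is open to \<open>step_quotE\<close>.\<close>

lemma tww_steps:
  assumes G: "is_graph G" and ne: "verts G \<noteq> {}"
  shows "\<exists>x. (step (tww G))\<^sup>*\<^sup>* (quot G id) (single x)"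
proof -
  have fin: "finite (verts G)"
    using G by (simp add: is_graph_def is_trigraph_def)
  obtain x where "(step (card (verts G)))\<^sup>*\<^sup>* G (single x)"
    using ex_steps_to_single[OF fin ne, of id] quot_id[OF G] by auto
  then have "\<exists>T. is_d_sequence (card (verts G)) G T"
    by (rule d_sequence_if_steps) (rule is_d_trigraph_graph[OF G])
  then have "\<exists>T. is_d_sequence (tww G) G T"
    using ne by (auto simp: tww_def intro: LeastI)
  then show ?thesis
    using steps_if_d_sequence ne fin quot_id[OF G] by metis
qed

lemma tww_leI:
  assumes "is_graph G" and "(step d)\<^sup>*\<^sup>* G (single x)"
  shows "tww G \<le> d"
  using d_sequence_if_steps[OF assms(2) is_d_trigraph_graph[OF assms(1)]]
  by (auto simp: tww_def intro: Least_le)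

section \<open>Degrees\<close>

lemma finite_nbhd:
  assumes "is_trigraph H"
  shows "finite (nbhd H i)"
proof (rule finite_subset)
  show "nbhd H i \<subseteq> verts H"
    using assms unfolding nbhd_def is_trigraph_def by blast
  show "finite (verts H)"
    using assms by (simp add: is_trigraph_def)
qed

lemma card_nbhd_le:
  assumes "is_trigraph H" and "i \<in> verts H"
  shows "card (nbhd H i) \<le> max_degree H"
  using assms by (auto simp: max_degree_def is_trigraph_def intro: Max_ge)

text \<open>Black neighbours are counted together with red ones because either kind may turn red in
  the product.\<close>

lemma card_nbhd_quot_le:
  assumes H: "is_graph H" and d: "is_d_trigraph d (quot H g)" and p: "p \<in> g ` verts H"
  shows "finite (nbhd (quot H g) p)" and "card (nbhd (quot H g) p) \<le> d + max_degree H"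
proof -
  have tri: "is_trigraph H" and fin: "finite (verts H)"
    using H by (simp_all add: is_graph_def is_trigraph_def)
  show "finite (nbhd (quot H g) p)"
    by (rule finite_nbhd[OF is_trigraph_quot[OF fin]])
  obtain i where i: "i \<in> verts H" "p = g i" using p by blast
  let ?B = "{q. {p, q} \<in> black (quot H g)}" and ?R = "{q. {p, q} \<in> red (quot H g)}"
  \<comment> \<open>One representative \<open>i\<close> suffices: complete adjacency gives it a
    neighbour in each class joined to \<open>p\<close> in black.\<close>
  have "?B \<subseteq> g ` nbhd H i"
    using i by (fastforce simp: black_quot_iff some_adj_def all_adj_def nbhd_def)
  then have "card ?B \<le> card (nbhd H i)"
    by (rule surj_card_le[OF finite_nbhd[OF tri]])
  also have "\<dots> \<le> max_degree H"
    by (rule card_nbhd_le[OF tri i(1)])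
  finally have "card ?B \<le> max_degree H" .
  moreover have "card ?R \<le> d"
    using d p unfolding is_d_trigraph_quot_iff[OF fin] by blast
  moreover have "nbhd (quot H g) p = ?R \<union> ?B"
    by (auto simp: nbhd_def)
  ultimately show "card (nbhd (quot H g) p) \<le> d + max_degree H"
    using card_Un_le[of ?R ?B] by simp
qed

section \<open>Contracting the Cartesian product\<close>

lemma verts_cart_prod [simp]: "verts (G \<box> H) = verts G \<times> verts H"
  by (simp add: cart_prod_def)

lemma black_cart_prod_iff:
  "{(x, i), (y, j)} \<in> black (G \<box> H) \<longleftrightarrow>
     x \<in> verts G \<and> y \<in> verts G \<and> i \<in> verts H \<and> j \<in> verts H \<and>
     (x = y \<and> {i, j} \<in> black H \<or> i = j \<and> {x, y} \<in> black G)"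
  by (auto simp: cart_prod_def doubleton_eq_iff insert_commute)

lemma no_loop: "is_graph G \<Longrightarrow> {x} \<notin> black G"
  unfolding is_graph_def is_trigraph_def by force

lemma is_graph_cart_prod:
  assumes "is_graph G" and "is_graph H"
  shows "is_graph (G \<box> H)"
  using assms no_loop[OF assms(1)] no_loop[OF assms(2)]
  by (fastforce simp: is_graph_def is_trigraph_def cart_prod_def card_2_iff)

section \<open>First phase: contracting the copies of \<open>G\<close>\<close>

lemma steps_in_copies:
  fixes G :: "'a trigraph" and H :: "'b trigraph"
  assumes G: "is_graph G" and H: "is_graph H"
    and uv: "u \<in> f ` verts G" "v \<in> f ` verts G" "u \<noteq> v" and w: "w \<notin> f ` verts G - {u, v}"
    and f': "f' = merge u v w \<circ> f"
    and d: "is_d_trigraph d (quot G f)" "is_d_trigraph d (quot G f')"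
    and D: "d + 2 * max_degree H \<le> D"
  shows "(step D)\<^sup>*\<^sup>* (quot (G \<box> H) (map_prod f id)) (quot (G \<box> H) (map_prod f' id))"
proof -
  \<comment> \<open>The intermediate labelling in which exactly the copies indexed by
    \<open>S\<close> have undergone the merge of \<open>u\<close> and \<open>v\<close>.\<close>
  define F where "F S = (\<lambda>(x, i). (if i \<in> S then f' x else f x, i))" for S :: "'b set"
  have tri: "is_trigraph H" and fin: "finite (verts H)" "finite (verts G)"
    using G H by (simp_all add: is_graph_def is_trigraph_def)
  have finP: "finite (verts (G \<box> H))" using fin by simp
  have deg: "is_d_trigraph D (quot (G \<box> H) (F S))" for S
    unfolding is_d_trigraph_quot_iff[OF finP]
  proof
    fix a assume "a \<in> F S ` verts (G \<box> H)"
    then obtain x0 i where i: "x0 \<in> verts G" "i \<in> verts H" and a: "a = F S (x0, i)" by auto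
    define h where "h j = (if j \<in> S then f' else f)" for j
    have F: "F S (x, j) = (h j x, j)" for x j by (simp add: F_def h_def)
    define p where "p = h i x0"
    have ap: "a = (p, i)" by (simp add: a F p_def)
    define R where "R = {q. {p, q} \<in> red (quot G (h i))}"
    \<comment> \<open>Product edges between different copies keep the first coordinate, so these are
      the only labels in copy \<open>j\<close> that the class of \<open>p\<close> in copy
      \<open>i\<close> can be adjacent to.\<close>
    define W where "W j = {h j x | x. x \<in> verts G \<and> h i x = p}" for j
    have R: "card R \<le> d"
      using d i by (auto simp: h_def R_def p_def is_d_trigraph_quot_iff[OF fin(2)])
    have Rf: "finite R"
    proof (rule finite_subset)
      show "R \<subseteq> h i ` verts G"
        using some_adj_labels[of G "h i"] by (auto simp: R_def red_quot_iff)
    qed (use fin in simp)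
    have W: "finite (W j) \<and> card (W j) \<le> 2" for j
    proof -
      \<comment> \<open>The \<open>f'\<close>-label is a function of the \<open>f\<close>-label, and
        conversely except that \<open>w\<close> stands for both \<open>u\<close> and
        \<open>v\<close>. So two labels can occur only when copy \<open>i\<close> is already
        contracted and copy \<open>j\<close> is not.\<close>
      have "W j \<subseteq> {u, v} \<or> (\<exists>r. W j \<subseteq> {r})"
      proof (cases "i \<in> S \<and> j \<notin> S")
        case True
        show ?thesis
        proof (cases "p = w")
          case True
          then have "W j \<subseteq> {u, v}"
            using w \<open>i \<in> S \<and> j \<notin> S\<close> by (auto simp: W_def h_def f' merge_def split: if_splits)
          then show ?thesis ..
        next
          case False
          then have "W j \<subseteq> {p}"
            using \<open>i \<in> S \<and> j \<notin> S\<close> by (auto simp: W_def h_def f' merge_def split: if_splits)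
          then show ?thesis by blast
        qed
      next
        case False
        then have "W j \<subseteq> {p} \<or> W j \<subseteq> {merge u v w p}"
          by (auto simp: W_def h_def f')
        then show ?thesis by blast
      qed
      then obtain r r' where "W j \<subseteq> {r, r'}" by blast
      moreover have "card {r, r'} \<le> 2" by (simp add: card_insert_if)
      ultimately show ?thesis
        by (meson card_mono finite.emptyI finite.insertI finite_subset order_trans)
    qed
    have sub: "{b. {a, b} \<in> red (quot (G \<box> H) (F S))} \<subseteq>
        (\<lambda>q. (q, i)) ` R \<union> (\<Union>j\<in>nbhd H i. (\<lambda>q. (q, j)) ` W j)" (is "?L \<subseteq> ?U \<union> ?V")
    proof (rule subsetI, unfold mem_Collect_eq)
      fix b assume b: "{a, b} \<in> red (quot (G \<box> H) (F S))"
      obtain q j where bq: "b = (q, j)" by (cases b)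
      obtain x y where xy: "x \<in> verts G" "y \<in> verts G" "h i x = p" "h j y = q" "j \<in> verts H"
        and e: "{(x, i), (y, j)} \<in> black (G \<box> H)"
        using b by (auto simp: red_quot_iff some_adj_def ap bq F)
      show "b \<in> ?U \<union> ?V"
      \<comment> \<open>Each copy induces \<open>G\<close>, so a red edge inside copy
        \<open>i\<close> is a red edge of \<open>quot G (h i)\<close>; any other red edge leads to a
        copy indexed by a neighbour of \<open>i\<close>.\<close>
      proof (cases "i = j")
        case True
        then have "some_adj G (h i) p q"
          using xy e no_loop[OF H] by (auto simp: some_adj_def black_cart_prod_iff)
        moreover have "\<not> all_adj G (h i) p q"
          using b True i by (auto simp: red_quot_iff all_adj_def ap bq F black_cart_prod_iff)
        moreover have "p \<noteq> q"
          using b True by (auto simp: red_quot_iff ap bq)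
        ultimately show ?thesis
          using True by (simp add: R_def red_quot_iff bq)
      next
        case False
        then have "x = y" "j \<in> nbhd H i"
          using e by (auto simp: black_cart_prod_iff nbhd_def)
        then have "q \<in> W j" using xy by (auto simp: W_def)
        then show ?thesis using \<open>j \<in> nbhd H i\<close> bq by blast
      qed
    qed
    have N: "finite (nbhd H i)" by (rule finite_nbhd[OF tri])
    have "finite (?U \<union> ?V)" using Rf W N by auto
    then have "card ?L \<le> card (?U \<union> ?V)" using sub by (rule card_mono)
    also have "\<dots> \<le> card ?U + card ?V" by (rule card_Un_le)
    also have "card ?U \<le> card R" using Rf by (rule card_image_le)
    also have "card ?V \<le> (\<Sum>j\<in>nbhd H i. card ((\<lambda>q. (q, j)) ` W j))"
      using N by (rule card_UN_le)
    also have "\<dots> \<le> (\<Sum>j\<in>nbhd H i. 2)"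
      using W by (intro sum_mono) (meson card_image_le order_trans)
    also have "\<dots> \<le> 2 * max_degree H"
      using card_nbhd_le[OF tri i(2)] by simp
    finally show "card ?L \<le> D" using R D by simp
  qed
  have "(step D)\<^sup>*\<^sup>* (quot (G \<box> H) (F {})) (quot (G \<box> H) (F S))" if "finite S" "S \<subseteq> verts H" for S
    using that
  proof (induction rule: finite_induct)
    case (insert i S)
    have "step D (quot (G \<box> H) (F S)) (quot (G \<box> H) (F (insert i S)))"
    proof (rule step_quotI[of "(u, i)" _ _ "(v, i)" "(w, i)"])
      \<comment> \<open>As \<open>i\<close> is not in \<open>S\<close>, copy \<open>i\<close> still
        carries the labels of \<open>f\<close>, and the hypotheses on \<open>u\<close>,
        \<open>v\<close> and \<open>w\<close> transfer to it.\<close>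
      have im: "(r, i) \<in> F S ` verts (G \<box> H) \<longleftrightarrow> r \<in> f ` verts G" for r
        using insert by (force simp: F_def)
      show "(u, i) \<in> F S ` verts (G \<box> H)" "(v, i) \<in> F S ` verts (G \<box> H)"
        "(w, i) \<notin> F S ` verts (G \<box> H) - {(u, i), (v, i)}" "(u, i) \<noteq> (v, i)"
        using uv w by (auto simp only: im Diff_iff insert_iff empty_iff prod.inject)
      show "F (insert i S) z = merge (u, i) (v, i) (w, i) (F S z)" for z
        using insert by (cases z) (auto simp: F_def merge_def f')
    qed (rule deg)
    then show ?case
      using insert by (meson insert_subset rtranclp.rtrancl_into_rtrancl)
  qed simp
  from this[OF fin(1)] have "(step D)\<^sup>*\<^sup>* (quot (G \<box> H) (F {})) (quot (G \<box> H) (F (verts H)))" by simp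
  moreover have "quot (G \<box> H) (F {}) = quot (G \<box> H) (map_prod f id)"
    by (rule quot_cong) (auto simp: F_def)
  moreover have "quot (G \<box> H) (F (verts H)) = quot (G \<box> H) (map_prod f' id)"
    by (rule quot_cong) (auto simp: F_def)
  ultimately show ?thesis by simp
qed

text \<open>The induction carries a labelling along with each trigraph, since the corresponding
  quotient of the product is built from the labelling.\<close>

lemma steps_first_factor:
  assumes G: "is_graph G" and H: "is_graph H"
    and "(step d)\<^sup>*\<^sup>* (quot G f) K" and "is_d_trigraph d (quot G f)"
    and D: "d + 2 * max_degree H \<le> D"
  shows "\<exists>f'. K = quot G f' \<and> is_d_trigraph d K \<and>
    (step D)\<^sup>*\<^sup>* (quot (G \<box> H) (map_prod f id)) (quot (G \<box> H) (map_prod f' id))"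
  using assms(3)
proof (induction rule: rtranclp_induct)
  case base
  then show ?case using assms(4) by blast
next
  case (step A B)
  then obtain g where g: "A = quot G g" "is_d_trigraph d (quot G g)"
    "(step D)\<^sup>*\<^sup>* (quot (G \<box> H) (map_prod f id)) (quot (G \<box> H) (map_prod g id))" by blast
  obtain u v w where h: "u \<in> g ` verts G" "v \<in> g ` verts G" "u \<noteq> v" "w \<notin> g ` verts G - {u, v}"
    and B: "B = quot G (merge u v w \<circ> g)" "is_d_trigraph d (quot G (merge u v w \<circ> g))"
    using step.hyps(2) unfolding g(1) by (rule step_quotE)
  have "(step D)\<^sup>*\<^sup>* (quot (G \<box> H) (map_prod g id)) (quot (G \<box> H) (map_prod (merge u v w \<circ> g) id))"
    by (rule steps_in_copies[OF G H h refl g(2) B(2) D])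
  then show ?case
    using rtranclp_trans[OF g(3)] B by blast
qed

section \<open>Second phase: contracting the remaining quotient of \<open>H\<close>\<close>

lemma is_d_trigraph_quot_second_factor:
  assumes G: "is_graph G" and H: "is_graph H" and d: "is_d_trigraph d (quot H g)"
    and D: "d + max_degree H \<le> D"
  shows "is_d_trigraph D (quot (G \<box> H) (\<lambda>(x, i). (c, g i)))"
    (is "is_d_trigraph D (quot ?P ?F)")
proof -
  have fin: "finite (verts ?P)"
    using G H by (simp add: is_graph_def is_trigraph_def)
  show ?thesis
    unfolding is_d_trigraph_quot_iff[OF fin]
  proof
    fix a assume "a \<in> ?F ` verts ?P"
    then obtain p where a: "a = (c, p)" and p: "p \<in> g ` verts H" by auto
    \<comment> \<open>With each copy of \<open>G\<close> collapsed to \<open>c\<close>, edges within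
      a copy disappear inside a class. An edge between classes comes from an edge of
      \<open>H\<close>, but may be red even where \<open>quot H g\<close> is black, so the whole
      neighbourhood is allowed for.\<close>
    have "{b. {a, b} \<in> red (quot ?P ?F)} \<subseteq> Pair c ` nbhd (quot H g) p" (is "?L \<subseteq> _")
      by (force simp: a red_quot_iff nbhd_quot_iff some_adj_def black_cart_prod_iff)
    then have "card ?L \<le> card (nbhd (quot H g) p)"
      by (rule surj_card_le[OF card_nbhd_quot_le(1)[OF H d p]])
    then show "card ?L \<le> D"
      using card_nbhd_quot_le(2)[OF H d p] D by simp
  qed
qed

lemma steps_second_factor:
  assumes G: "is_graph G" and H: "is_graph H" and ne: "verts G \<noteq> {}"
    and "(step d)\<^sup>*\<^sup>* (quot H g) K" and "is_d_trigraph d (quot H g)"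
    and D: "d + max_degree H \<le> D"
  shows "\<exists>g'. K = quot H g' \<and>
    (step D)\<^sup>*\<^sup>* (quot (G \<box> H) (\<lambda>(x, i). (c, g i))) (quot (G \<box> H) (\<lambda>(x, i). (c, g' i)))"
  using assms(4)
proof (induction rule: rtranclp_induct)
  case base
  then show ?case by blast
next
  case (step A B)
  then obtain k where k: "A = quot H k"
    "(step D)\<^sup>*\<^sup>* (quot (G \<box> H) (\<lambda>(x, i). (c, g i))) (quot (G \<box> H) (\<lambda>(x, i). (c, k i)))" by blast
  obtain u v w where h: "u \<in> k ` verts H" "v \<in> k ` verts H" "u \<noteq> v" "w \<notin> k ` verts H - {u, v}"
    and B: "B = quot H (merge u v w \<circ> k)" "is_d_trigraph d (quot H (merge u v w \<circ> k))"
    using step.hyps(2) unfolding k(1) by (rule step_quotE)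
  let ?F = "\<lambda>(x, i). (c, k i)"
  have "step D (quot (G \<box> H) ?F) (quot (G \<box> H) (\<lambda>(x, i). (c, (merge u v w \<circ> k) i)))"
  proof (rule step_quotI[of "(c, u)" _ _ "(c, v)" "(c, w)"])
    \<comment> \<open>A vertex of \<open>G\<close> is needed for the label \<open>(c, r)\<close> to
      occur at all.\<close>
    have im: "(c, r) \<in> ?F ` verts (G \<box> H) \<longleftrightarrow> r \<in> k ` verts H" for r
      using ne by force
    show "(c, u) \<in> ?F ` verts (G \<box> H)" "(c, v) \<in> ?F ` verts (G \<box> H)"
      "(c, w) \<notin> ?F ` verts (G \<box> H) - {(c, u), (c, v)}" "(c, u) \<noteq> (c, v)"
      using h by (auto simp only: im Diff_iff insert_iff empty_iff prod.inject)
    show "(case z of (x, i) \<Rightarrow> (c, (merge u v w \<circ> k) i)) = merge (c, u) (c, v) (c, w) (?F z)" for z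
      by (cases z) (auto simp: merge_def)
  qed (rule is_d_trigraph_quot_second_factor[OF G H B(2) D])
  then show ?case
    using k(2) B(1) by (intro exI[of _ "merge u v w \<circ> k"] conjI) (auto simp del: o_apply)
qed

theorem theorem3p1:
  fixes G :: "'a trigraph" and H :: "'b trigraph"
  assumes "is_graph G" and "is_graph H"
  shows "tww (G \<box> H) \<le> max (tww G + max_degree H) (tww H) + max_degree H"
proof (cases "verts G = {} \<or> verts H = {}")
  case True
  \<comment> \<open>The product then has no vertices, so its twin-width is 0 by convention.\<close>
  then show ?thesis by (auto simp: tww_def)
next
  case False
  then have ne: "verts G \<noteq> {}" "verts H \<noteq> {}" by auto
  let ?P = "G \<box> H" and ?D = "max (tww G + max_degree H) (tww H) + max_degree H"
  have P: "is_graph ?P" by (rule is_graph_cart_prod[OF assms])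
  \<comment> \<open>The two terms of the maximum pay for the two phases; the added
    \<open>max_degree H\<close> serves both.\<close>
  have D: "tww G + 2 * max_degree H \<le> ?D" "tww H + max_degree H \<le> ?D"
    by linarith+
  have start_G: "is_d_trigraph (tww G) (quot G id)" and start_H: "is_d_trigraph (tww H) (quot H id)"
    using assms by (simp_all add: quot_id is_d_trigraph_graph)
  obtain c where "(step (tww G))\<^sup>*\<^sup>* (quot G id) (single c)"
    using tww_steps[OF assms(1) ne(1)] by blast
  then obtain f where f: "single c = quot G f"
    and s1: "(step ?D)\<^sup>*\<^sup>* (quot ?P (map_prod id id)) (quot ?P (map_prod f id))"
    using steps_first_factor[OF assms _ _ D(1)] start_G by blast
  have "f ` verts G = {c}" using f by (metis trigraph.select_convs(1) verts_quot)
  \<comment> \<open>A one-vertex quotient forces \<open>f\<close> to be constant, so the first phase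
    ends exactly where the second begins, with the labelling \<open>id\<close> of
    \<open>H\<close>.\<close>
  then have "quot ?P (map_prod f id) = quot ?P (\<lambda>(x, i). (c, id i))"
    by (intro quot_cong) auto
  moreover obtain e where "(step (tww H))\<^sup>*\<^sup>* (quot H id) (single e)"
    using tww_steps[OF assms(2) ne(2)] by blast
  from steps_second_factor[OF assms ne(1) this start_H D(2), of c]
  obtain g where g: "single e = quot H g"
    and s2: "(step ?D)\<^sup>*\<^sup>* (quot ?P (\<lambda>(x, i). (c, id i))) (quot ?P (\<lambda>(x, i). (c, g i)))"
    by (elim exE conjE)
  have "g ` verts H = {e}" using g by (metis trigraph.select_convs(1) verts_quot)
  then have "quot ?P (\<lambda>(x, i). (c, g i)) = single (c, e)"
    using ne by (intro quot_const) auto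
  ultimately have "(step ?D)\<^sup>*\<^sup>* (quot ?P id) (single (c, e))"
    using s1 s2 by (simp add: map_prod.id)
  then show ?thesis
    using tww_leI[OF P] quot_id[OF P] by metis
qed

end
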